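(* Let $A\in\mathbb{R}^{m\times n}$ and $1\le k\le\operatorname{rank}(A)$. Let $P_1,P_2$ be permutation matrices and consider the partial LU factorization $$P_1AP_2=\begin{bmatrix}A_{11}&A_{12}\\ A_{21}&A_{22}\end{bmatrix}=\begin{bmatrix}I_k&0\\ A_{21}A_{11}^{-1}&I_{m-k}\end{bmatrix}\begin{bmatrix}A_{11}&A_{12}\\0&S(A_{11})\end{bmatrix},\qquad S(A_{11})=A_{22}-A_{21}A_{11}^{-1}A_{12},$$ with $A_{11}\in\mathbb{R}^{k\times k}$ invertible. Suppose that for some $\mu,\nu\ge1$: 1. $\sigma_k(A)\le\mu\,\sigma_k(A_{11})$, 2. $\|S(A_{11})\|_2\le\mu\,\sigma_{k+1}(A)$, and 3. $\|A_{21}A_{11}^{-1}\|_{\max}\le\nu$ and $\|A_{11}^{-1}A_{12}\|_{\max}\le\nu$. Then $A_{11}$ is a $\gamma$-local maximum volume $k\times k$ submatrix of $A$ for some $\gamma\le\nu^2+\mu^2$.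
   Context: $\sigma_1(M)\ge\sigma_2(M)\ge\cdots\ge0$ denote the singular values of a real matrix $M$, $\|M\|_2$ is the spectral norm, and $\|M\|_{\max}$ is the maximum absolute value of its entries. If $k=\min(m,n)$, then $\sigma_{k+1}(A)=0$ and $S(A_{11})$ is empty; norms of empty matrices are $0$. The volume of $M\in\mathbb{R}^{p\times q}$ is $\mathrm{vol}(M)=\prod_{j=1}^{\min(p,q)}\sigma_j(M)$ (so $|\det M|$ if $M$ is square). A $p\times q$ submatrix of $A$ is specified by a set of $p$ row indices and a set of $q$ column indices. For $\gamma>1$, a $p\times q$ submatrix $B$ of $A$ is a $\gamma$-local maximum volume submatrix (near-local maximum volume with parameter $\gamma$) if $\mathrm{vol}(B)\ge\frac1\gamma\mathrm{vol}(\hat B)$ for all $p\times q$ submatrices $\hat B$ of $A$ that differ from $B$ in at most one row and at most one column (i.e. at most one row index is replaced and at most one column index is replaced). *)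

theory Defs
  imports
    "Jordan_Normal_Form.Char_Poly"
    "Jordan_Normal_Form.DL_Rank"
    "Jordan_Normal_Form.DL_Submatrix"
    "Jordan_Normal_Form.Gauss_Jordan_Elimination"
    "HOL-Combinatorics.Permutations"
begin

text \<open>The singular values of \<open>M\<close> are the square roots of the eigenvalues of
  \<open>M\<^sup>T M\<close>, counted with multiplicity, in decreasing order. As \<open>M\<^sup>T M\<close> is symmetric and positive
  semidefinite, its characteristic polynomial splits over the reals with nonnegative roots, so the
  list has length \<open>dim_col M\<close>; its entries beyond position \<open>min (dim_row M) (dim_col M)\<close> are 0.\<close>

definition singular_values :: "real mat \<Rightarrow> real list" where
  "singular_values M =
     rev (sorted_list_of_multiset
       (image_mset sqrt (proots (char_poly (transpose_mat M * M)))))"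

text \<open>\<open>sigma j M\<close> is the \<open>j\<close>-th largest singular value, numbered from \<open>j = 1\<close> (the value at
  \<open>j = 0\<close> has no meaning).\<close>

definition sigma :: "nat \<Rightarrow> real mat \<Rightarrow> real" where
  "sigma j M =
     (if j \<le> length (singular_values M) then singular_values M ! (j - 1) else 0)"

definition vol :: "real mat \<Rightarrow> real" where
  "vol M = (\<Prod>j = 1..min (dim_row M) (dim_col M). sigma j M)"

definition norm2_vec :: "real vec \<Rightarrow> real" where
  "norm2_vec v = sqrt (v \<bullet> v)"

text \<open>The operator norm induced by the Euclidean norms. With \<open>\<le> 1\<close> rather than \<open>= 1\<close> the zero
  vector is admitted, which makes the norm of an empty matrix 0.\<close>

definition spectral_norm :: "real mat \<Rightarrow> real" where
  "spectral_norm M =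
     Sup {norm2_vec (M *\<^sub>v v) | v. v \<in> carrier_vec (dim_col M) \<and> norm2_vec v \<le> 1}"

text \<open>Inserting 0 only matters for empty matrices.\<close>

definition max_norm :: "real mat \<Rightarrow> real" where
  "max_norm M = Max (insert 0 (abs ` elements_mat M))"

text \<open>Meaningful for invertible matrices only.\<close>

definition mat_inv :: "real mat \<Rightarrow> real mat" where
  "mat_inv M = the (mat_inverse M)"

definition schur_complement ::
    "real mat \<Rightarrow> real mat \<Rightarrow> real mat \<Rightarrow> real mat \<Rightarrow> real mat" where
  "schur_complement A11 A12 A21 A22 = A22 - A21 * mat_inv A11 * A12"

definition permutation_mat :: "nat \<Rightarrow> real mat \<Rightarrow> bool" where
  "permutation_mat n P \<longleftrightarrow>
     (\<exists>\<pi>. \<pi> permutes {..<n} \<and> P = mat n n (\<lambda>(i, j). if j = \<pi> i then 1 else 0))"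

text \<open>\<open>B\<close> is the submatrix of \<open>A\<close> with row indices \<open>I\<close> and column indices \<open>J\<close>. Since
  \<open>submatrix A I J\<close> lists rows and columns in increasing order of their indices, while the leading
  block of \<open>P\<^sub>1 A P\<^sub>2\<close> may list them in any order, \<open>B\<close> may differ from it by row and column
  permutations. These do not affect the volume.\<close>

definition is_submatrix_at ::
    "real mat \<Rightarrow> nat set \<Rightarrow> nat set \<Rightarrow> real mat \<Rightarrow> bool" where
  "is_submatrix_at A I J B \<longleftrightarrow>
     I \<subseteq> {..<dim_row A} \<and> J \<subseteq> {..<dim_col A} \<and>
     (\<exists>P Q. permutation_mat (card I) P \<and> permutation_mat (card J) Q \<and>
            B = P * submatrix A I J * Q)"

text \<open>The index sets \<open>I\<close>, \<open>J\<close> are explicit, because \<open>B\<close> as a matrix need not determine its position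
  in \<open>A\<close>.\<close>

definition local_max_vol ::
    "real \<Rightarrow> real mat \<Rightarrow> nat set \<Rightarrow> nat set \<Rightarrow> real mat \<Rightarrow> bool" where
  "local_max_vol \<gamma> A I J B \<longleftrightarrow>
     \<gamma> > 1 \<and> is_submatrix_at A I J B \<and>
     (\<forall>I' J'. I' \<subseteq> {..<dim_row A} \<longrightarrow> J' \<subseteq> {..<dim_col A} \<longrightarrow>
        card I' = card I \<longrightarrow> card J' = card J \<longrightarrow>
        card (I - I') \<le> 1 \<longrightarrow> card (J - J') \<le> 1 \<longrightarrow>
        vol B \<ge> 1 / \<gamma> * vol (submatrix A I' J'))"

text \<open>Row \<open>i\<close> of \<open>P * A\<close> is row \<open>r\<close> of \<open>A\<close> iff \<open>P $$ (i, r) = 1\<close>, and column \<open>j\<close> of \<open>A * P\<close> is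
  column \<open>c\<close> of \<open>A\<close> iff \<open>P $$ (c, j) = 1\<close>. So these are the indices of the rows (columns) of \<open>A\<close>
  that are moved to the first \<open>k\<close> positions.\<close>

definition leading_rows :: "nat \<Rightarrow> real mat \<Rightarrow> nat set" where
  "leading_rows k P = {r. r < dim_col P \<and> (\<exists>i<k. P $$ (i, r) = 1)}"

definition leading_cols :: "nat \<Rightarrow> real mat \<Rightarrow> nat set" where
  "leading_cols k P = {c. c < dim_row P \<and> (\<exists>j<k. P $$ (c, j) = 1)}"

end

theory Submission
  imports Defs
begin

text \<open>
  The determinant of a \<open>k \<times> k\<close> matrix changes in a simple way when one row and one column of it are
  exchanged. Let the new row be \<open>r\<^sup>T A\<^sub>1\<^sub>1\<close> and the new column \<open>A\<^sub>1\<^sub>1 c\<close> outside their common entry,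
  and let that entry be \<open>r\<^sup>T A\<^sub>1\<^sub>1 c + s\<close>. If they take the places of row \<open>p\<close> and column \<open>q\<close>, the
  determinant is multiplied by \<open>r\<^sub>p c\<^sub>q + s (A\<^sub>1\<^sub>1\<^sup>-\<^sup>1)\<^sub>q\<^sub>p\<close> (lemma \<open>det_row_column_exchange\<close>).

  When the new row and column come from the other blocks of the partitioned matrix, \<open>r\<close> is a row of
  \<open>A\<^sub>2\<^sub>1 A\<^sub>1\<^sub>1\<^sup>-\<^sup>1\<close>, \<open>c\<close> is a column of \<open>A\<^sub>1\<^sub>1\<^sup>-\<^sup>1 A\<^sub>1\<^sub>2\<close> and \<open>s\<close> is an entry of the Schur complement
  (lemma \<open>abs_det_exchange_le\<close>). So the first term is at most \<open>\<nu>\<^sup>2\<close> in absolute value. For the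
  second term, an entry of a matrix is at most its spectral norm, hence
  \<open>\<bar>s\<bar> \<le> \<mu> \<sigma>\<^sub>k\<^sub>+\<^sub>1(A) \<le> \<mu> \<sigma>\<^sub>k(A) \<le> \<mu>\<^sup>2 \<sigma>\<^sub>k(A\<^sub>1\<^sub>1)\<close>, while the entries of \<open>A\<^sub>1\<^sub>1\<^sup>-\<^sup>1\<close> times \<open>\<sigma>\<^sub>k(A\<^sub>1\<^sub>1)\<close> are
  at most 1 (lemma \<open>abs_entry_inverse_le\<close>). The product is at most \<open>\<mu>\<^sup>2\<close>, and no exchange increases
  the volume by more than the factor \<open>\<nu>\<^sup>2 + \<mu>\<^sup>2\<close>.

  Two facts on singular values enter. The volume of a square matrix is the absolute value of its
  determinant (lemma \<open>vol_square_matrix\<close>); this holds because the characteristic polynomial of a real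
  symmetric matrix splits over the reals. And \<open>\<sigma>\<^sub>k\<close> of a matrix with \<open>k\<close> columns bounds from below
  how much it shrinks vectors (lemma \<open>sigma_min_lower_bound\<close>); this holds because the infimum of the
  Rayleigh quotient of a symmetric matrix is an eigenvalue (lemma \<open>rayleigh_minimum_is_eigenvalue\<close>).
\<close>

section \<open>Quadratic forms and Rayleigh quotients\<close>

text \<open>Since \<open>\<bar>x\<^sub>i x\<^sub>j\<bar> \<le> x \<bullet> x\<close>, the sum of the absolute values of the entries is such a
  constant. The additional 1 makes it positive, so that one can divide by it.\<close>

lemma quadratic_form_upper_bound:
  fixes K :: "real mat"
  assumes K: "K \<in> carrier_mat n n"
  shows "\<exists>C>0. \<forall>x\<in>carrier_vec n. x \<bullet> (K *\<^sub>v x) \<le> C * (x \<bullet> x)"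
proof (intro exI conjI ballI)
  define C where "C = 1 + (\<Sum>i<n. \<Sum>j<n. \<bar>K $$ (i, j)\<bar>)"
  have "(\<Sum>i<n. \<Sum>j<n. \<bar>K $$ (i, j)\<bar>) \<ge> 0"
    by (intro sum_nonneg) auto
  then show "C > 0"
    by (simp add: C_def)
  fix x :: "real vec"
  assume x: "x \<in> carrier_vec n"
  have xx: "x \<bullet> x = (\<Sum>i<n. (x $ i)\<^sup>2)"
    using x by (auto simp: scalar_prod_def power2_eq_square lessThan_atLeast0)
  have coord: "(x $ i)\<^sup>2 \<le> x \<bullet> x" if "i < n" for i
    unfolding xx using that by (intro member_le_sum) auto
  have "x $ i * x $ j * K $$ (i, j) \<le> \<bar>K $$ (i, j)\<bar> * (x \<bullet> x)" if "i < n" "j < n" for i j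
  proof -
    have "0 \<le> (\<bar>x $ i\<bar> - \<bar>x $ j\<bar>)\<^sup>2"
      by simp
    then have "2 * (\<bar>x $ i\<bar> * \<bar>x $ j\<bar>) \<le> (x $ i)\<^sup>2 + (x $ j)\<^sup>2"
      by (simp add: power2_diff)
    then have "\<bar>x $ i\<bar> * \<bar>x $ j\<bar> \<le> x \<bullet> x"
      using coord[OF that(1)] coord[OF that(2)] by linarith
    from mult_left_mono[OF this, of "\<bar>K $$ (i, j)\<bar>"]
    have "\<bar>x $ i * x $ j * K $$ (i, j)\<bar> \<le> \<bar>K $$ (i, j)\<bar> * (x \<bullet> x)"
      by (simp add: abs_mult ac_simps)
    then show ?thesis
      by linarith
  qed
  then have "(\<Sum>i<n. \<Sum>j<n. x $ i * x $ j * K $$ (i, j))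
      \<le> (\<Sum>i<n. \<Sum>j<n. \<bar>K $$ (i, j)\<bar> * (x \<bullet> x))"
    by (intro sum_mono) auto
  also have "\<dots> = (C - 1) * (x \<bullet> x)"
    by (simp add: C_def sum_distrib_right)
  also have "(\<Sum>i<n. \<Sum>j<n. x $ i * x $ j * K $$ (i, j)) = x \<bullet> (K *\<^sub>v x)"
    using K x by (auto simp: scalar_prod_def lessThan_atLeast0 sum_distrib_left ac_simps intro!: sum.cong)
  finally show "x \<bullet> (K *\<^sub>v x) \<le> C * (x \<bullet> x)"
    using sum_nonneg[of "{..<n}" "\<lambda>i. (x $ i)\<^sup>2"] by (simp add: algebra_simps xx)
qed

lemma scalar_prod_self_nonneg: "0 \<le> (v :: real vec) \<bullet> v"
  by (auto simp: scalar_prod_def intro!: sum_nonneg)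

lemma scalar_prod_self_eq_0:
  fixes v :: "real vec"
  assumes "v \<in> carrier_vec n" and "v \<bullet> v = 0"
  shows "v = 0\<^sub>v n"
  using assms by (auto simp: scalar_prod_def sum_nonneg_eq_0_iff intro!: eq_vecI)

lemma symmetric_form_swap:
  fixes H :: "real mat"
  assumes H: "H \<in> carrier_mat n n" and sym: "transpose_mat H = H"
    and u: "u \<in> carrier_vec n" and v: "v \<in> carrier_vec n"
  shows "u \<bullet> (H *\<^sub>v v) = v \<bullet> (H *\<^sub>v u)"
proof -
  have "u \<bullet> (H *\<^sub>v v) = (H *\<^sub>v u) \<bullet> v"
    using transpose_vec_mult_scalar[OF H v u] sym by simp
  then show ?thesis
    using comm_scalar_prod[of v n "H *\<^sub>v u"] H u v by simp
qed

text \<open>The nonnegative quadratic polynomial \<open>t \<mapsto> (u + t v) \<bullet> Q (u + t v)\<close> has a nonpositive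
  discriminant.\<close>

lemma psd_cauchy_schwarz:
  fixes Q :: "real mat"
  assumes Q: "Q \<in> carrier_mat n n" and sym: "transpose_mat Q = Q"
    and psd: "\<And>v. v \<in> carrier_vec n \<Longrightarrow> 0 \<le> v \<bullet> (Q *\<^sub>v v)"
    and u: "u \<in> carrier_vec n" and v: "v \<in> carrier_vec n"
  shows "(u \<bullet> (Q *\<^sub>v v))\<^sup>2 \<le> (u \<bullet> (Q *\<^sub>v u)) * (v \<bullet> (Q *\<^sub>v v))"
proof -
  define a b c where abc: "a = u \<bullet> (Q *\<^sub>v u)" "b = u \<bullet> (Q *\<^sub>v v)" "c = v \<bullet> (Q *\<^sub>v v)"
  have Qu: "Q *\<^sub>v u \<in> carrier_vec n" and Qv: "Q *\<^sub>v v \<in> carrier_vec n"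
    using Q u v by auto
  have expand: "0 \<le> a + 2 * t * b + t\<^sup>2 * c" for t
  proof -
    have "(u + t \<cdot>\<^sub>v v) \<bullet> (Q *\<^sub>v (u + t \<cdot>\<^sub>v v)) = a + 2 * t * b + t\<^sup>2 * c"
      using Q u v Qu Qv symmetric_form_swap[OF Q sym v u]
      by (simp add: mult_add_distrib_mat_vec[OF Q] mult_mat_vec[OF Q]
          add_scalar_prod_distrib[of _ n] scalar_prod_add_distrib[of _ n] abc
          power2_eq_square algebra_simps)
    then show ?thesis
      using psd[of "u + t \<cdot>\<^sub>v v"] u v by simp
  qed
  have c: "0 \<le> c"
    using psd[OF v] by (simp add: abc)
  have "b\<^sup>2 \<le> a * c"
  proof (cases "c = 0")
    case True
    have "b = 0"
    proof (rule ccontr)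
      assume "b \<noteq> 0"
      then show False
        \<comment> \<open>At this \<open>t\<close> the now affine function has the value \<open>-1\<close>.\<close>
        using expand[of "- (a + 1) / (2 * b)"] True by (simp add: field_simps)
    qed
    then show ?thesis
      using True by simp
  next
    case False
    then have "0 \<le> c * (a + 2 * (- b / c) * b + (- b / c)\<^sup>2 * c)"
      using expand[of "- b / c"] c by (intro mult_nonneg_nonneg) auto
    also have "\<dots> = a * c - b\<^sup>2"
      using False by (simp add: field_simps power2_eq_square)
    finally show ?thesis
      by simp
  qed
  then show ?thesis
    by (simp add: abc)
qed

lemma det_nonzero_inverse:
  fixes Q :: "real mat"
  assumes Q: "Q \<in> carrier_mat n n" and "det Q \<noteq> 0"
  obtains K where "K \<in> carrier_mat n n" "Q * K = 1\<^sub>m n" "K * Q = 1\<^sub>m n"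
proof -
  from det_non_zero_imp_unit[OF assms, of "()"] show ?thesis
    using that by (auto simp: Units_def ring_mat_def)
qed

text \<open>Let \<open>\<rho>\<close> be the infimum of the Rayleigh quotient, so that \<open>Q = H - \<rho> I\<close> is positive
  semidefinite. If \<open>\<rho>\<close> were not an eigenvalue, \<open>Q\<close> would have an inverse \<open>K\<close>. For a unit vector \<open>v\<close> the
  Cauchy-Schwarz inequality of the form \<open>Q\<close> would then give \<open>1 = (K v \<bullet> Q v)\<^sup>2 \<le> (v \<bullet> K v) (v \<bullet> Q v) \<le> C (v \<bullet> Q v)\<close>, and the
  Rayleigh quotient would stay above \<open>\<rho> + 1 / C\<close>.\<close>

lemma rayleigh_minimum_is_eigenvalue:
  fixes H :: "real mat"
  assumes H: "H \<in> carrier_mat n n" and sym: "transpose_mat H = H" and n: "0 < n"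
  obtains \<rho> where "eigenvalue H \<rho>"
    and "\<And>v. v \<in> carrier_vec n \<Longrightarrow> \<rho> * (v \<bullet> v) \<le> v \<bullet> (H *\<^sub>v v)"
proof -
  define R where "R = {v \<bullet> (H *\<^sub>v v) | v. v \<in> carrier_vec n \<and> v \<bullet> v = 1}"
  define \<rho> where "\<rho> = Inf R"
  have nonempty: "R \<noteq> {}"
    using n by (auto simp: R_def intro!: exI[of _ "unit_vec n 0"])
  obtain C where C: "\<And>x. x \<in> carrier_vec n \<Longrightarrow> x \<bullet> (- H *\<^sub>v x) \<le> C * (x \<bullet> x)"
    using quadratic_form_upper_bound[of "- H" n] H by auto
  have bounded: "bdd_below R"
  proof (rule bdd_belowI)
    fix r assume "r \<in> R"
    then obtain v where v: "v \<in> carrier_vec n" "v \<bullet> v = 1" "r = v \<bullet> (H *\<^sub>v v)"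
      by (auto simp: R_def)
    have "- H *\<^sub>v v = - (H *\<^sub>v v)"
      using H v by (auto intro!: eq_vecI)
    then show "- C \<le> r"
      using C[OF v(1)] v H by (auto simp: scalar_prod_uminus_right)
  qed
  have rayleigh: "\<sigma> * (v \<bullet> v) \<le> v \<bullet> (H *\<^sub>v v)"
    if v: "v \<in> carrier_vec n" and \<sigma>: "\<And>r. r \<in> R \<Longrightarrow> \<sigma> \<le> r" for \<sigma> v
  proof (cases "v \<bullet> v = 0")
    case True
    then show ?thesis
      using scalar_prod_self_eq_0[OF v] H by auto
  next
    case False
    define s where "s = sqrt (v \<bullet> v)"
    have ss: "s\<^sup>2 = v \<bullet> v" "s \<noteq> 0"
      using False scalar_prod_self_nonneg[of v] by (auto simp: s_def)
    define w where "w = (1 / s) \<cdot>\<^sub>v v"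
    have w: "w \<in> carrier_vec n" "w \<bullet> w = 1"
      using v ss by (auto simp: w_def power2_eq_square)
    have "w \<bullet> (H *\<^sub>v w) = (v \<bullet> (H *\<^sub>v v)) / s\<^sup>2"
      using v H by (simp add: w_def mult_mat_vec[OF H v] power2_eq_square)
    moreover have "\<sigma> \<le> w \<bullet> (H *\<^sub>v w)"
      using w by (intro \<sigma>) (auto simp: R_def)
    ultimately show ?thesis
      using ss False scalar_prod_self_nonneg[of v] by (simp add: pos_le_divide_eq)
  qed
  have below: "\<rho> * (v \<bullet> v) \<le> v \<bullet> (H *\<^sub>v v)" if "v \<in> carrier_vec n" for v
    using that by (rule rayleigh) (auto simp: \<rho>_def intro: cInf_lower bounded)
  define Q where "Q = char_matrix H \<rho>"
  have Q: "Q \<in> carrier_mat n n"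
    using H by (simp add: Q_def)
  have Qv: "Q *\<^sub>v v = H *\<^sub>v v - \<rho> \<cdot>\<^sub>v v" if "v \<in> carrier_vec n" for v
    using that H by (auto simp: Q_def char_matrix_def add_mult_distrib_mat_vec[of _ n n] intro!: eq_vecI)
  have form: "v \<bullet> (Q *\<^sub>v v) = v \<bullet> (H *\<^sub>v v) - \<rho> * (v \<bullet> v)" if "v \<in> carrier_vec n" for v
    using that H by (simp add: Qv scalar_prod_minus_distrib[of _ n])
  have symQ: "transpose_mat Q = Q"
  proof (rule eq_matI)
    fix i j assume ij: "i < dim_row Q" "j < dim_col Q"
    then have "H $$ (j, i) = H $$ (i, j)"
      using H Q sym by (metis carrier_matD index_transpose_mat(1))
    then show "transpose_mat Q $$ (i, j) = Q $$ (i, j)"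
      using ij H Q by (auto simp: Q_def char_matrix_def)
  qed (use Q in auto)
  have psd: "0 \<le> v \<bullet> (Q *\<^sub>v v)" if "v \<in> carrier_vec n" for v
    using that below form by simp
  have "eigenvalue H \<rho>"
  proof (rule ccontr)
    assume "\<not> eigenvalue H \<rho>"
    then have "det Q \<noteq> 0"
      using eigenvalue_det[OF H] by (simp add: Q_def)
    then obtain K where K: "K \<in> carrier_mat n n" "Q * K = 1\<^sub>m n"
      using det_nonzero_inverse[OF Q] by metis
    obtain C where C: "C > 0" "\<And>x. x \<in> carrier_vec n \<Longrightarrow> x \<bullet> (K *\<^sub>v x) \<le> C * (x \<bullet> x)"
      using quadratic_form_upper_bound[OF K(1)] by auto
    \<comment> \<open>The Rayleigh quotient keeps the distance \<open>1 / C\<close> from its infimum.\<close>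
    have coercive: "\<rho> + 1 / C \<le> r" if r: "r \<in> R" for r
    proof -
      obtain v where v: "v \<in> carrier_vec n" "v \<bullet> v = 1" "r = v \<bullet> (H *\<^sub>v v)"
        using r by (auto simp: R_def)
      have Kv: "K *\<^sub>v v \<in> carrier_vec n"
        using K v by auto
      have QKv: "Q *\<^sub>v (K *\<^sub>v v) = v"
        using assoc_mult_mat_vec[OF Q K(1) v(1)] K v by simp
      have "1 = ((K *\<^sub>v v) \<bullet> (Q *\<^sub>v v))\<^sup>2"
        using symmetric_form_swap[OF Q symQ Kv v(1)] QKv v by simp
      also have "\<dots> \<le> ((K *\<^sub>v v) \<bullet> v) * (v \<bullet> (Q *\<^sub>v v))"
        using psd_cauchy_schwarz[OF Q symQ psd Kv v(1)] QKv by simp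
      also have "(K *\<^sub>v v) \<bullet> v = v \<bullet> (K *\<^sub>v v)"
        using Kv v by (intro comm_scalar_prod)
      also have "(v \<bullet> (K *\<^sub>v v)) * (v \<bullet> (Q *\<^sub>v v)) \<le> C * (v \<bullet> (Q *\<^sub>v v))"
        using C(2)[OF v(1)] v psd by (intro mult_right_mono) auto
      finally have "1 / C \<le> v \<bullet> (Q *\<^sub>v v)"
        using C(1) by (simp add: field_simps)
      then show ?thesis
        using form[OF v(1)] v by simp
    qed
    have "\<rho> + 1 / C \<le> \<rho>"
      unfolding \<rho>_def using nonempty coercive by (intro cInf_greatest) (auto simp: \<rho>_def)
    then show False
      using C by simp
  qed
  then show ?thesis
    using below that by blast
qed

section \<open>Real roots of symmetric characteristic polynomials\<close>

text \<open>If \<open>x + i y\<close> is an eigenvector for \<open>z\<close>, comparing \<open>y \<bullet> H x\<close> with \<open>x \<bullet> H y\<close> gives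
  \<open>Im z (x \<bullet> x + y \<bullet> y) = 0\<close>.\<close>

lemma symmetric_complex_eigenvalue_real:
  fixes H :: "real mat"
  assumes H: "H \<in> carrier_mat n n" and sym: "transpose_mat H = H"
    and ev: "eigenvalue (map_mat complex_of_real H) z"
  shows "Im z = 0"
proof -
  let ?H = "map_mat complex_of_real H"
  obtain v where v: "v \<in> carrier_vec n" "v \<noteq> 0\<^sub>v n" "?H *\<^sub>v v = z \<cdot>\<^sub>v v"
    using ev H by (auto simp: eigenvalue_def eigenvector_def)
  define x y where xy: "x = map_vec Re v" "y = map_vec Im v"
  have x: "x \<in> carrier_vec n" and y: "y \<in> carrier_vec n"
    using v by (auto simp: xy)
  have comp: "(H *\<^sub>v x) $ i = Re z * x $ i - Im z * y $ i \<and>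
      (H *\<^sub>v y) $ i = Im z * x $ i + Re z * y $ i" if "i < n" for i
  proof -
    have "(\<Sum>j = 0..<n. complex_of_real (H $$ (i, j)) * v $ j) = z * v $ i"
      using arg_cong[OF v(3), of "\<lambda>w. w $ i"] that H v(1) by (simp add: scalar_prod_def)
    from arg_cong[OF this, of Re] arg_cong[OF this, of Im] show ?thesis
      using that H v(1) by (simp add: scalar_prod_def xy algebra_simps)
  qed
  have Hx: "H *\<^sub>v x = Re z \<cdot>\<^sub>v x - Im z \<cdot>\<^sub>v y" and Hy: "H *\<^sub>v y = Im z \<cdot>\<^sub>v x + Re z \<cdot>\<^sub>v y"
    using comp H x y by (auto intro!: eq_vecI)
  have "Im z * (x \<bullet> x + y \<bullet> y) = 0"
    using symmetric_form_swap[OF H sym y x] comm_scalar_prod[OF x y] x y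
    by (simp add: Hx Hy scalar_prod_minus_distrib[of _ n] scalar_prod_add_distrib[of _ n]
        algebra_simps)
  moreover have "x \<bullet> x + y \<bullet> y \<noteq> 0"
  proof
    assume "x \<bullet> x + y \<bullet> y = 0"
    then have "x = 0\<^sub>v n" "y = 0\<^sub>v n"
      using scalar_prod_self_nonneg[of x] scalar_prod_self_nonneg[of y]
      by (auto intro!: scalar_prod_self_eq_0 x y)
    then have "v $ i = 0" if "i < n" for i
      using that v(1) by (metis carrier_vecD complex_eqI index_map_vec(1) index_zero_vec(1)
          xy zero_complex.simps)
    then have "v = 0\<^sub>v n"
      using v(1) by (intro eq_vecI) auto
    then show False
      using v(2) by simp
  qed
  ultimately show ?thesis
    by simp
qed

text \<open>Over the complex numbers the polynomial splits; its roots are eigenvalues, hence real, so the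
  same factorization holds over the reals.\<close>

lemma symmetric_char_poly_splits:
  fixes H :: "real mat"
  assumes H: "H \<in> carrier_mat n n" and sym: "transpose_mat H = H"
  obtains rs where "char_poly H = (\<Prod>r\<leftarrow>rs. [:- r, 1:])" and "length rs = n"
proof -
  let ?H = "map_mat complex_of_real H"
  obtain as where as: "char_poly ?H = (\<Prod>a\<leftarrow>as. [:- a, 1:])" "length as = n"
    using char_poly_factorized[of ?H n] H by auto
  have real: "complex_of_real (Re a) = a" if "a \<in> set as" for a
  proof -
    have "poly (char_poly ?H) a = 0"
      using that by (auto simp: as poly_prod_list prod_list_zero_iff)
    then have "eigenvalue ?H a"
      using eigenvalue_root_char_poly[of ?H n] H by simp
    then show ?thesis
      using symmetric_complex_eigenvalue_real[OF H sym] by (simp add: complex_eq_iff)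
  qed
  interpret of_real_poly: map_poly_inj_idom_hom complex_of_real ..
  have "map_poly complex_of_real (\<Prod>r\<leftarrow>map Re as. [:- r, 1:]) = (\<Prod>a\<leftarrow>as. [:- a, 1:])"
    using real by (auto simp: of_real_poly.hom_prod_list o_def intro!: arg_cong[of _ _ prod_list])
  then have "map_poly complex_of_real (char_poly H)
      = map_poly complex_of_real (\<Prod>r\<leftarrow>map Re as. [:- r, 1:])"
    using of_real_hom.char_poly_hom[OF H, where 'a = complex] as by simp
  then have "char_poly H = (\<Prod>r\<leftarrow>map Re as. [:- r, 1:])"
    by (rule of_real_poly.injectivity)
  then show ?thesis
    by (rule that) (simp add: as)
qed

section \<open>Singular values\<close>

lemma gram_carrier: "M \<in> carrier_mat p q \<Longrightarrow> transpose_mat M * M \<in> carrier_mat q q"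
  by auto

lemma gram_symmetric: "transpose_mat (transpose_mat M * (M :: real mat)) = transpose_mat M * M"
  by (subst transpose_mult[of _ "dim_col M" "dim_row M" _ "dim_col M"]) auto

lemma gram_form:
  fixes M :: "real mat"
  assumes M: "M \<in> carrier_mat p q" and v: "v \<in> carrier_vec q"
  shows "v \<bullet> ((transpose_mat M * M) *\<^sub>v v) = (M *\<^sub>v v) \<bullet> (M *\<^sub>v v)"
proof -
  have "(transpose_mat M * M) *\<^sub>v v = transpose_mat M *\<^sub>v (M *\<^sub>v v)"
    using M v by (intro assoc_mult_mat_vec) auto
  then have "v \<bullet> ((transpose_mat M * M) *\<^sub>v v) = (transpose_mat M *\<^sub>v (M *\<^sub>v v)) \<bullet> v"
    using M v by (simp add: comm_scalar_prod[of _ q])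
  also have "\<dots> = (M *\<^sub>v v) \<bullet> (M *\<^sub>v v)"
    using transpose_vec_mult_scalar[OF M v, of "M *\<^sub>v v"] M v 
    by (metis mult_mat_vec_carrier transpose_carrier_mat transpose_vec_mult_scalar)
  finally show ?thesis .
qed

lemma gram_eigenvalue_nonneg:
  fixes M :: "real mat"
  assumes "eigenvalue (transpose_mat M * M) e"
  shows "0 \<le> e"
proof -
  define q where "q = dim_col M"
  have M: "M \<in> carrier_mat (dim_row M) q"
    by (auto simp: q_def)
  obtain v where v: "v \<in> carrier_vec q" "v \<noteq> 0\<^sub>v q" "(transpose_mat M * M) *\<^sub>v v = e \<cdot>\<^sub>v v"
    using assms by (auto simp: eigenvalue_def eigenvector_def q_def)
  have "e * (v \<bullet> v) = (M *\<^sub>v v) \<bullet> (M *\<^sub>v v)"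
    using gram_form[OF M v(1)] v by simp
  moreover have "0 < v \<bullet> v"
    using scalar_prod_self_nonneg[of v] scalar_prod_self_eq_0[OF v(1)] v(2) by force
  ultimately show ?thesis
    using scalar_prod_self_nonneg[of "M *\<^sub>v v"] by (metis mult_neg_pos not_le)
qed

lemma mset_singular_values:
  "mset (singular_values M) = image_mset sqrt (proots (char_poly (transpose_mat M * M)))"
  by (simp add: singular_values_def)

lemma proots_gram:
  "x \<in># proots (char_poly (transpose_mat M * M)) \<longleftrightarrow> eigenvalue (transpose_mat M * (M :: real mat)) x"
proof -
  have G: "transpose_mat M * M \<in> carrier_mat (dim_col M) (dim_col M)"
    by auto
  then have "char_poly (transpose_mat M * M) \<noteq> 0"
    using degree_monic_char_poly[OF G] by auto
  then show ?thesis
    using eigenvalue_root_char_poly[OF G] by simp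
qed

lemma set_singular_values:
  "set (singular_values M) = {sqrt x | x. eigenvalue (transpose_mat M * M) x}"
proof -
  have "set (singular_values M) = set_mset (mset (singular_values M))"
    by simp
  also have "\<dots> = {sqrt x | x. eigenvalue (transpose_mat M * M) x}"
    unfolding mset_singular_values using proots_gram by auto
  finally show ?thesis .
qed

lemma singular_values_nonneg: "s \<in> set (singular_values M) \<Longrightarrow> 0 \<le> s"
  using gram_eigenvalue_nonneg by (auto simp: set_singular_values)

lemma singular_values_antimono:
  assumes "i \<le> j" "j < length (singular_values M)"
  shows "singular_values M ! j \<le> singular_values M ! i"
proof -
  have "sorted (rev (singular_values M))"
    by (simp add: singular_values_def)
  then show ?thesis
    using assms by (metis sorted_rev_iff_nth_mono)
qed

lemma sigma_Suc_le:
  assumes "1 \<le> k"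
  shows "sigma (k + 1) M \<le> sigma k M"
proof (cases "k + 1 \<le> length (singular_values M)")
  case True
  then show ?thesis
    using singular_values_antimono[of "k - 1" k M] by (simp add: sigma_def)
next
  case False
  then show ?thesis
    using singular_values_nonneg[of _ M] assms by (auto simp: sigma_def)
qed

text \<open>The number of singular values and their product are read off the splitting of the
  characteristic polynomial of the Gram matrix: its degree, and its value at 0.\<close>

lemma singular_values_gram_splits:
  fixes M :: "real mat"
  assumes M: "M \<in> carrier_mat p q"
  shows "length (singular_values M) = q"
    and "(prod_list (singular_values M))\<^sup>2 = det (transpose_mat M * M)"
proof -
  let ?G = "transpose_mat M * M"
  have G: "?G \<in> carrier_mat q q"
    using M by auto
  obtain rs where rs: "char_poly ?G = (\<Prod>r\<leftarrow>rs. [:- r, 1:])" "length rs = q"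
    using symmetric_char_poly_splits[OF G gram_symmetric] .
  have "proots (\<Prod>r\<leftarrow>rs. [:- r, 1:]) = mset rs"
    by (induction rs) (auto simp: proots_mult prod_list_zero_iff image_iff simp del: mult_pCons_left)
  then have mset: "proots (char_poly ?G) = mset rs"
    by (simp add: rs)
  then have svs: "mset (singular_values M) = mset (map sqrt rs)"
    by (simp add: mset_singular_values)
  then show "length (singular_values M) = q"
    using rs mset_eq_length by fastforce
  have "set rs = set_mset (proots (char_poly ?G))"
    by (simp add: mset)
  then have nonneg: "\<forall>r\<in>set rs. 0 \<le> r"
    using gram_eigenvalue_nonneg proots_gram by blast
  have "(prod_list (singular_values M))\<^sup>2 = (prod_list (map sqrt rs))\<^sup>2"
    by (metis prod_mset_prod_list svs)
  also have "\<dots> = prod_list rs"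
    using nonneg by (induction rs) (auto simp: power_mult_distrib)
  also have "\<dots> = (-1) ^ q * poly (char_poly ?G) 0"
    unfolding rs(1) rs(2)[symmetric] by (induction rs) auto
  also have "poly (char_poly ?G) 0 = det (- char_matrix ?G 0)"
    by (rule char_poly_matrix[OF G])
  also have "- char_matrix ?G 0 = (-1) \<cdot>\<^sub>m ?G"
    using G by (auto simp: char_matrix_def intro!: eq_matI)
  also have "(-1) ^ q * det ((-1) \<cdot>\<^sub>m ?G) = det ?G"
    using G M by (simp add: det_smult flip: power_mult_distrib)
  finally show "(prod_list (singular_values M))\<^sup>2 = det ?G" .
qed

lemma vol_square_matrix:
  fixes M :: "real mat"
  assumes M: "M \<in> carrier_mat k k"
  shows "vol M = \<bar>det M\<bar>"
proof -
  note len = singular_values_gram_splits(1)[OF M]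
  have "vol M = (\<Prod>j = 1..k. singular_values M ! (j - 1))"
    using M len by (simp add: vol_def sigma_def)
  also have "\<dots> = (\<Prod>j = 0..<k. singular_values M ! j)"
    by (rule prod.reindex_bij_witness[of _ Suc "\<lambda>j. j - 1"]) auto
  also have "\<dots> = prod_list (singular_values M)"
    by (simp add: prod.list_conv_set_nth len)
  finally have vol: "vol M = prod_list (singular_values M)" .
  have "0 \<le> prod_list (singular_values M)"
    using singular_values_nonneg by (intro prod_list_nonneg) auto
  moreover have "(vol M)\<^sup>2 = det (transpose_mat M * M)"
    by (simp only: vol singular_values_gram_splits(2)[OF M])
  moreover have "det (transpose_mat M * M) = (det M)\<^sup>2"
    using M det_transpose[OF M] by (simp add: det_mult[of _ k] power2_eq_square)
  ultimately show ?thesis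
    by (metis abs_of_nonneg real_sqrt_abs vol)
qed

text \<open>Since \<open>M\<close> has \<open>k\<close> columns, \<open>sigma k M\<close> is the last entry of the list of singular values, thus
  at most the square root of the eigenvalue of the Gram matrix that bounds its Rayleigh quotient from
  below.\<close>

lemma sigma_min_lower_bound:
  fixes M :: "real mat"
  assumes M: "M \<in> carrier_mat p k" and k: "1 \<le> k" and v: "v \<in> carrier_vec k"
  shows "(sigma k M)\<^sup>2 * (v \<bullet> v) \<le> (M *\<^sub>v v) \<bullet> (M *\<^sub>v v)"
proof -
  let ?G = "transpose_mat M * M"
  obtain \<rho> where \<rho>: "eigenvalue ?G \<rho>" "\<rho> * (v \<bullet> v) \<le> v \<bullet> (?G *\<^sub>v v)"
    using rayleigh_minimum_is_eigenvalue[OF gram_carrier[OF M] gram_symmetric] k v by auto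
  have len: "length (singular_values M) = k"
    by (rule singular_values_gram_splits(1)[OF M])
  have "sqrt \<rho> \<in> set (singular_values M)"
    using \<rho> by (auto simp: set_singular_values)
  then obtain j where j: "j < k" "sqrt \<rho> = singular_values M ! j"
    by (metis in_set_conv_nth len)
  then have "sigma k M \<le> sqrt \<rho>"
    using singular_values_antimono[of j "k - 1" M] k len by (simp add: sigma_def)
  moreover have "0 \<le> sigma k M"
    using k len singular_values_nonneg[of _ M] by (simp add: sigma_def)
  ultimately have "(sigma k M)\<^sup>2 \<le> (sqrt \<rho>)\<^sup>2"
    by (intro power_mono)
  also have "(sqrt \<rho>)\<^sup>2 = \<rho>"
    using gram_eigenvalue_nonneg[OF \<rho>(1)] by simp
  finally have "(sigma k M)\<^sup>2 * (v \<bullet> v) \<le> \<rho> * (v \<bullet> v)"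
    using scalar_prod_self_nonneg by (rule mult_right_mono)
  then show ?thesis
    using \<rho>(2) gram_form[OF M v] by simp
qed

section \<open>Bounds on single entries\<close>

lemma abs_entry_le_norm2_vec:
  fixes w :: "real vec"
  assumes "i < dim_vec w"
  shows "\<bar>w $ i\<bar> \<le> norm2_vec w"
proof -
  have "(w $ i)\<^sup>2 \<le> w \<bullet> w"
    unfolding scalar_prod_def power2_eq_square using assms
    by (intro member_le_sum[of i "{0..<dim_vec w}" "\<lambda>i. w $ i * w $ i"]) auto
  then show ?thesis
    unfolding norm2_vec_def by (metis real_le_rsqrt real_sqrt_abs real_sqrt_le_iff)
qed

text \<open>Apply the lower bound for \<open>M\<close> to column \<open>j\<close> of \<open>N\<close>, which \<open>M\<close> maps to a unit vector. This
  is the entrywise form of \<open>\<parallel>M\<^sup>-\<^sup>1\<parallel> \<le> 1 / \<sigma>\<^sub>k(M)\<close>.\<close>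

lemma abs_entry_inverse_le:
  fixes M N :: "real mat"
  assumes M: "M \<in> carrier_mat k k" and N: "N \<in> carrier_mat k k" and MN: "M * N = 1\<^sub>m k"
    and ij: "i < k" "j < k"
  shows "sigma k M * \<bar>N $$ (i, j)\<bar> \<le> 1"
proof -
  define v where "v = N *\<^sub>v unit_vec k j"
  have v: "v \<in> carrier_vec k"
    using N by (auto simp: v_def)
  have "M *\<^sub>v v = unit_vec k j"
    using assoc_mult_mat_vec[OF M N, of "unit_vec k j"] MN by (simp add: v_def)
  then have "(sigma k M)\<^sup>2 * (v \<bullet> v) \<le> 1"
    using sigma_min_lower_bound[OF M _ v] ij by simp
  moreover have "v $ i = N $$ (i, j)"
    using N ij by (simp add: v_def)
  then have "\<bar>N $$ (i, j)\<bar> \<le> norm2_vec v"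
    using abs_entry_le_norm2_vec[of i v] v ij by simp
  then have "(N $$ (i, j))\<^sup>2 \<le> v \<bullet> v"
    using scalar_prod_self_nonneg[of v] by (simp add: norm2_vec_def sqrt_ge_absD)
  then have "(sigma k M)\<^sup>2 * (N $$ (i, j))\<^sup>2 \<le> (sigma k M)\<^sup>2 * (v \<bullet> v)"
    by (intro mult_left_mono) auto
  ultimately have "(sigma k M * \<bar>N $$ (i, j)\<bar>)\<^sup>2 \<le> 1\<^sup>2"
    by (simp add: power_mult_distrib)
  then show ?thesis
    by (rule power2_le_imp_le) simp
qed

text \<open>The entry is a coordinate of the image of a unit vector. A supremum of reals bounds its set
  only if the set is bounded, which comes from the upper bound on the form of the Gram matrix.\<close>

lemma abs_entry_le_spectral_norm:
  fixes S :: "real mat"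
  assumes S: "S \<in> carrier_mat p q" and ij: "i < p" "j < q"
  shows "\<bar>S $$ (i, j)\<bar> \<le> spectral_norm S"
proof -
  let ?N = "{norm2_vec (S *\<^sub>v v) | v. v \<in> carrier_vec (dim_col S) \<and> norm2_vec v \<le> 1}"
  obtain C where C: "C > 0" "\<And>v. v \<in> carrier_vec q \<Longrightarrow> v \<bullet> ((transpose_mat S * S) *\<^sub>v v) \<le> C * (v \<bullet> v)"
    using quadratic_form_upper_bound[OF gram_carrier[OF S]] by auto
  have "bdd_above ?N"
  proof (rule bdd_aboveI)
    fix x assume "x \<in> ?N"
    then obtain v where v: "v \<in> carrier_vec q" "norm2_vec v \<le> 1" "x = norm2_vec (S *\<^sub>v v)"
      using S by auto
    have "(S *\<^sub>v v) \<bullet> (S *\<^sub>v v) \<le> C * (v \<bullet> v)"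
      using C(2)[OF v(1)] gram_form[OF S v(1)] by simp
    also have "\<dots> \<le> C * 1"
      using v C by (intro mult_left_mono) (auto simp: norm2_vec_def)
    finally show "x \<le> sqrt C"
      using v by (simp add: norm2_vec_def)
  qed
  moreover have "norm2_vec (S *\<^sub>v unit_vec q j) \<in> ?N"
    using S ij by (auto simp: norm2_vec_def)
  ultimately have "norm2_vec (S *\<^sub>v unit_vec q j) \<le> spectral_norm S"
    unfolding spectral_norm_def by (intro cSup_upper)
  moreover have "(S *\<^sub>v unit_vec q j) $ i = S $$ (i, j)"
    using S ij by simp
  ultimately show ?thesis
    using abs_entry_le_norm2_vec[of i "S *\<^sub>v unit_vec q j"] S ij by simp
qed

lemma abs_entry_le_max_norm:
  assumes "i < dim_row M" "j < dim_col M"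
  shows "\<bar>M $$ (i, j)\<bar> \<le> max_norm M"
proof -
  have "elements_mat M = (\<lambda>(i, j). M $$ (i, j)) ` ({..<dim_row M} \<times> {..<dim_col M})"
    by (force simp: elements_mat_def image_iff)
  then show ?thesis
    using assms unfolding max_norm_def by (intro Max_ge) auto
qed

section \<open>Determinants after exchanging a row and a column\<close>

text \<open>Without the summand \<open>s\<close>, the matrix \<open>M\<close> arises from \<open>B\<close> by replacing column \<open>q\<close> with \<open>B c\<close>
  and then row \<open>p\<close> with the combination of rows given by \<open>r\<close>; by Cramer's rule the two steps multiply
  the determinant by \<open>c\<^sub>q\<close> and \<open>r\<^sub>p\<close>. The summand \<open>s\<close> in the corner contributes \<open>s\<close> times a cofactor
  that avoids the exchanged row and column, which is therefore a cofactor of \<open>B\<close> itself and an entry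
  of \<open>det B \<cdot> B\<^sup>-\<^sup>1\<close>.\<close>

lemma det_row_column_exchange:
  fixes B M N :: "'a :: comm_ring_1 mat"
  assumes B: "B \<in> carrier_mat k k" and M: "M \<in> carrier_mat k k" and N: "N \<in> carrier_mat k k"
    and BN: "B * N = 1\<^sub>m k"
    and r: "r \<in> carrier_vec k" and c: "c \<in> carrier_vec k"
    and p: "p < k" and q: "q < k"
    and same: "\<And>i j. i < k \<Longrightarrow> j < k \<Longrightarrow> i \<noteq> p \<Longrightarrow> j \<noteq> q \<Longrightarrow> M $$ (i, j) = B $$ (i, j)"
    and new_col: "\<And>i. i < k \<Longrightarrow> i \<noteq> p \<Longrightarrow> M $$ (i, q) = (B *\<^sub>v c) $ i"
    and new_row: "\<And>j. j < k \<Longrightarrow> j \<noteq> q \<Longrightarrow> M $$ (p, j) = (transpose_mat B *\<^sub>v r) $ j"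
    and corner: "M $$ (p, q) = r \<bullet> (B *\<^sub>v c) + s"
  shows "det M = det B * (r $ p * c $ q + s * N $$ (q, p))"
proof -
  define K where "K = replace_col B (B *\<^sub>v c) q"
  have K: "K \<in> carrier_mat k k"
    using B by (simp add: K_def replace_col_def)
  \<comment> \<open>\<open>T\<close> is \<open>K\<close> with row \<open>p\<close> replaced by \<open>r\<^sup>T K\<close>.\<close>
  define T where "T = transpose_mat (replace_col (transpose_mat K) (transpose_mat K *\<^sub>v r) p)"
  have T: "T \<in> carrier_mat k k"
    using K by (simp add: T_def replace_col_def)
  have detT: "det T = r $ p * (c $ q * det B)"
  proof -
    have "det T = det (replace_col (transpose_mat K) (transpose_mat K *\<^sub>v r) p)"
      unfolding T_def using K by (intro det_transpose[of _ k]) (simp add: replace_col_def)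
    also have "\<dots> = r $ p * det (transpose_mat K)"
      using K r p by (intro cramer_lemma_mat[of _ k]) auto
    also have "det (transpose_mat K) = c $ q * det B"
      using cramer_lemma_mat[OF B c q] det_transpose[OF K] by (simp add: K_def)
    finally show ?thesis .
  qed
  have T_index: "T $$ (i, j) = (if i = p then col K j \<bullet> r else K $$ (i, j))"
    if "i < k" "j < k" for i j
    using that K by (simp add: T_def replace_col_def)
  have K_index: "K $$ (i, j) = (if j = q then (B *\<^sub>v c) $ i else B $$ (i, j))"
    if "i < k" "j < k" for i j
    using that B by (simp add: K_def replace_col_def)
  have K_col: "col K j = (if j = q then B *\<^sub>v c else col B j)" if "j < k" for j
    using that B K K_index by (auto intro!: eq_vecI)
  have other_rows: "M $$ (i, j) = T $$ (i, j)" if "i < k" "j < k" "i \<noteq> p" for i j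
    using that same new_col by (auto simp: T_index K_index)
  have row_p: "M $$ (p, j) = T $$ (p, j) + (if j = q then s else 0)" if "j < k" for j
    using that p B r c new_row corner by (auto simp: T_index K_col comm_scalar_prod[of r k])
  have cofactor_M: "cofactor M p j = cofactor T p j" for j
    unfolding cofactor_def using other_rows M T p
    by (auto simp: mat_delete_def intro!: arg_cong[of _ _ det] cong_mat arg_cong2[of _ _ _ _ "(*)"])
  have cofactor_T: "cofactor T p q = cofactor B p q"
    unfolding cofactor_def using B T p
    by (auto simp: mat_delete_def T_index K_index intro!: arg_cong[of _ _ det] cong_mat arg_cong2[of _ _ _ _ "(*)"])
  have "adj_mat B = adj_mat B * (B * N)"
    using adj_mat(1)[OF B] BN by simp
  also have "\<dots> = (adj_mat B * B) * N"
    using adj_mat(1)[OF B] B N by (intro assoc_mult_mat[symmetric]) auto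
  also have "\<dots> = det B \<cdot>\<^sub>m N"
    using N by (simp add: adj_mat(3)[OF B] mult_smult_assoc_mat[of _ k k])
  finally have "adj_mat B $$ (q, p) = (det B \<cdot>\<^sub>m N) $$ (q, p)"
    by (rule arg_cong)
  then have cofactor_B: "cofactor B p q = det B * N $$ (q, p)"
    using B N p q by (simp add: adj_mat_def)
  have "det M = (\<Sum>j<k. M $$ (p, j) * cofactor M p j)"
    by (rule laplace_expansion_row[OF M p])
  also have "\<dots> = (\<Sum>j<k. T $$ (p, j) * cofactor T p j + (if j = q then s * cofactor T p q else 0))"
    by (intro sum.cong) (auto simp: row_p cofactor_M algebra_simps)
  also have "\<dots> = det T + s * cofactor T p q"
    using q by (simp add: sum.distrib laplace_expansion_row[OF T p])
  finally show ?thesis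
    by (simp add: detT cofactor_T cofactor_B algebra_simps)
qed

text \<open>With \<open>L = A\<^sub>2\<^sub>1 N\<close> and \<open>U = N A\<^sub>1\<^sub>2\<close>, a row of the lower blocks has the coefficients \<open>r = row L\<close>
  in terms of the rows of \<open>A\<^sub>1\<^sub>1\<close>, a column of the right blocks has the coefficients \<open>c = col U\<close>, and
  their common entry exceeds \<open>r \<bullet> A\<^sub>1\<^sub>1 c\<close> by an entry of the Schur complement. If \<open>p' < k\<close> or \<open>q' < k\<close>,
  the new row or column is already one of \<open>A\<^sub>1\<^sub>1\<close>: its coefficients form a unit vector and \<open>s = 0\<close>, so
  exchanging only a row, only a column, or nothing is covered.\<close>

lemma abs_det_exchange_le:
  fixes A11 A12 A21 A22 N :: "real mat"
  assumes A11: "A11 \<in> carrier_mat k k" and A12: "A12 \<in> carrier_mat k n"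
    and A21: "A21 \<in> carrier_mat m k" and A22: "A22 \<in> carrier_mat m n"
    and N: "N \<in> carrier_mat k k" "A11 * N = 1\<^sub>m k" "N * A11 = 1\<^sub>m k"
    and \<nu>: "1 \<le> \<nu>"
    and L_le: "\<And>i j. i < m \<Longrightarrow> j < k \<Longrightarrow> \<bar>(A21 * N) $$ (i, j)\<bar> \<le> \<nu>"
    and U_le: "\<And>i j. i < k \<Longrightarrow> j < n \<Longrightarrow> \<bar>(N * A12) $$ (i, j)\<bar> \<le> \<nu>"
    and \<beta>: "0 \<le> \<beta>"
    and S_le: "\<And>i j. i < m \<Longrightarrow> j < n \<Longrightarrow>
      \<bar>(A22 - A21 * N * A12) $$ (i, j)\<bar> * \<bar>N $$ (q, p)\<bar> \<le> \<beta>"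
    and p: "p < k" and q: "q < k" and p': "p' < k + m" and q': "q' < k + n"
  shows "\<bar>det (mat k k (\<lambda>(i, j). four_block_mat A11 A12 A21 A22 $$
      (if i = p then p' else i, if j = q then q' else j)))\<bar> \<le> (\<nu>\<^sup>2 + \<beta>) * \<bar>det A11\<bar>"
proof -
  let ?C = "four_block_mat A11 A12 A21 A22"
  define L U S where "L = A21 * N" "U = N * A12" "S = A22 - A21 * N * A12"
  have L: "L \<in> carrier_mat m k" and U: "U \<in> carrier_mat k n" and S: "S \<in> carrier_mat m n"
    using A11 A12 A21 A22 N by (auto simp: L_U_S_def)
  have LA: "L * A11 = A21"
    using A11 A21 N by (simp add: L_U_S_def assoc_mult_mat[of _ m k _ k _ k])
  have AU: "A11 * U = A12"
    using A11 A12 N assoc_mult_mat[of A11 k k N k A12 n, symmetric] by (simp add: L_U_S_def)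
  define r where "r = (if p' < k then unit_vec k p' else row L (p' - k))"
  define c where "c = (if q' < k then unit_vec k q' else col U (q' - k))"
  define s where "s = (if p' < k \<or> q' < k then 0 else S $$ (p' - k, q' - k))"
  have r: "r \<in> carrier_vec k" and c: "c \<in> carrier_vec k"
    using L U by (auto simp: r_def c_def)
  have Br: "(transpose_mat A11 *\<^sub>v r) $ j = ?C $$ (p', j)" if j: "j < k" for j
  proof (cases "p' < k")
    case True
    then show ?thesis
      using j A11 by (simp add: r_def)
  next
    case False
    then have "(transpose_mat A11 *\<^sub>v r) $ j = (L * A11) $$ (p' - k, j)"
      using j A11 L p' comm_scalar_prod[of "col A11 j" k "row L (p' - k)"] row_carrier_vec[of "p' - k" m L k]
      by (simp add: r_def)
    then show ?thesis
      using False j p' A11 A22 by (simp add: LA)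
  qed
  have Bc: "(A11 *\<^sub>v c) $ i = ?C $$ (i, q')" if i: "i < k" for i
  proof (cases "q' < k")
    case True
    then show ?thesis
      using i A11 by (simp add: c_def)
  next
    case False
    then have "(A11 *\<^sub>v c) $ i = (A11 * U) $$ (i, q' - k)"
      using i A11 U q' by (simp add: c_def)
    then show ?thesis
      using False i q' A11 A22 by (simp add: AU)
  qed
  have corner: "?C $$ (p', q') = r \<bullet> (A11 *\<^sub>v c) + s"
  proof (cases "p' < k")
    case True
    then show ?thesis
      using Bc[OF True] A11 c by (simp add: r_def s_def)
  next
    case p'_ge: False
    show ?thesis
    proof (cases "q' < k")
      case True
      have "r \<bullet> (A11 *\<^sub>v c) = (transpose_mat A11 *\<^sub>v r) \<bullet> c"
        using transpose_vec_mult_scalar[OF A11 c r] by simp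
      then show ?thesis
        using Br[OF True] A11 r True by (simp add: c_def s_def)
    next
      case False
      have "A11 *\<^sub>v c = col A12 (q' - k)"
        using False Bc A11 A12 A22 c q' by (auto intro!: eq_vecI)
      then have "r \<bullet> (A11 *\<^sub>v c) = (L * A12) $$ (p' - k, q' - k)"
        using p'_ge False p' q' L A12 by (simp add: r_def)
      then show ?thesis
        using p'_ge False p' q' A11 A12 A21 A22 N by (simp add: s_def L_U_S_def)
    qed
  qed
  have "\<bar>r $ p\<bar> \<le> \<nu>"
    using L_le[of "p' - k" p, folded L_U_S_def] L p p' \<nu> by (auto simp: r_def)
  moreover have "\<bar>c $ q\<bar> \<le> \<nu>"
    using U_le[of q "q' - k", folded L_U_S_def] U q q' \<nu> by (auto simp: c_def)
  ultimately have rc: "\<bar>r $ p * c $ q\<bar> \<le> \<nu>\<^sup>2"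
    unfolding abs_mult power2_eq_square using \<nu> by (intro mult_mono) auto
  have sN: "\<bar>s * N $$ (q, p)\<bar> \<le> \<beta>"
    using S_le[of "p' - k" "q' - k"] p' q' \<beta> by (auto simp: s_def L_U_S_def(3) abs_mult)
  have "det (mat k k (\<lambda>(i, j). ?C $$ (if i = p then p' else i, if j = q then q' else j)))
      = det A11 * (r $ p * c $ q + s * N $$ (q, p))"
    using A11 by (intro det_row_column_exchange[OF A11 _ N(1,2) r c p q])
      (auto simp: p q Br Bc corner simp del: index_mult_mat_vec)
  moreover have "\<bar>r $ p * c $ q + s * N $$ (q, p)\<bar> \<le> \<nu>\<^sup>2 + \<beta>"
    using rc sN by linarith
  then have "\<bar>det A11 * (r $ p * c $ q + s * N $$ (q, p))\<bar> \<le> (\<nu>\<^sup>2 + \<beta>) * \<bar>det A11\<bar>"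
    unfolding abs_mult by (subst mult.commute) (intro mult_right_mono abs_ge_zero)
  ultimately show ?thesis
    by simp
qed

section \<open>Enumerations of index sets\<close>

lemma bij_betw_differ_by_permutation:
  assumes f: "bij_betw f K I" and g: "bij_betw g K I"
  obtains \<sigma> where "\<sigma> permutes K" and "\<And>i. i \<in> K \<Longrightarrow> g (\<sigma> i) = f i"
proof -
  define \<sigma> where "\<sigma> i = (if i \<in> K then inv_into K g (f i) else i)" for i
  have "bij_betw (inv_into K g \<circ> f) K K"
    using bij_betw_trans[OF f bij_betw_inv_into[OF g]] .
  then have "bij_betw \<sigma> K K"
    by (rule bij_betw_cong[THEN iffD1, rotated]) (simp add: \<sigma>_def)
  then have "\<sigma> permutes K"
    by (rule bij_imp_permutes) (simp add: \<sigma>_def)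
  moreover have "g (\<sigma> i) = f i" if "i \<in> K" for i
    using that f g by (simp add: \<sigma>_def bij_betw_apply bij_betw_inv_into_right)
  ultimately show ?thesis
    using that by blast
qed

lemma abs_det_reorder_rows:
  fixes F :: "nat \<Rightarrow> nat \<Rightarrow> 'a :: linordered_idom"
  assumes "bij_betw f {..<k} I" and "bij_betw g {..<k} I"
  shows "\<bar>det (mat k k (\<lambda>(i, j). F (f i) j))\<bar> = \<bar>det (mat k k (\<lambda>(i, j). F (g i) j))\<bar>"
proof -
  obtain \<sigma> where \<sigma>: "\<sigma> permutes {..<k}" "\<And>i. i < k \<Longrightarrow> g (\<sigma> i) = f i"
    using bij_betw_differ_by_permutation[OF assms] by auto
  let ?G = "mat k k (\<lambda>(i, j). F (g i) j)"
  have "\<sigma> i < k" if "i < k" for i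
    using permutes_in_image[OF \<sigma>(1), of i] that by simp
  then have "mat k k (\<lambda>(i, j). F (f i) j) = mat k k (\<lambda>(i, j). ?G $$ (\<sigma> i, j))"
    using \<sigma>(2) by (intro cong_mat) auto
  moreover have "det (mat k k (\<lambda>(i, j). ?G $$ (\<sigma> i, j))) = signof \<sigma> * det ?G"
    using \<sigma>(1) by (intro det_permute_rows) (auto simp: lessThan_atLeast0)
  ultimately show ?thesis
    by (simp add: abs_mult sign_def)
qed

text \<open>This makes the order in which rows and columns are listed irrelevant for the volume.\<close>

lemma abs_det_reorder:
  fixes F :: "nat \<Rightarrow> nat \<Rightarrow> 'a :: linordered_idom"
  assumes rows: "bij_betw f {..<k} I" "bij_betw f' {..<k} I"
    and cols: "bij_betw g {..<k} J" "bij_betw g' {..<k} J"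
  shows "\<bar>det (mat k k (\<lambda>(i, j). F (f i) (g j)))\<bar> = \<bar>det (mat k k (\<lambda>(i, j). F (f' i) (g' j)))\<bar>"
proof -
  have transposed: "det (mat k k (\<lambda>(i, j). F (f' i) (h j))) = det (mat k k (\<lambda>(j, i). F (f' i) (h j)))" for h
    by (subst det_transpose[symmetric, of _ k]) (auto intro!: arg_cong[of _ _ det] eq_matI)
  have "\<bar>det (mat k k (\<lambda>(i, j). F (f i) (g j)))\<bar> = \<bar>det (mat k k (\<lambda>(i, j). F (f' i) (g j)))\<bar>"
    by (rule abs_det_reorder_rows[OF rows, of "\<lambda>a j. F a (g j)"])
  also have "\<dots> = \<bar>det (mat k k (\<lambda>(i, j). F (f' i) (g' j)))\<bar>"
    unfolding transposed by (rule abs_det_reorder_rows[OF cols, of "\<lambda>b i. F (f' i) b"])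
  finally show ?thesis .
qed

lemma bij_betw_pick:
  assumes "finite I"
  shows "bij_betw (pick I) {..<card I} I"
proof -
  have "inj_on (pick I) {..<card I}"
    by (rule linorder_inj_onI') (use pick_mono_le in fastforce)
  moreover have "pick I ` {..<card I} \<subseteq> I"
    using pick_in_set_le by auto
  ultimately show ?thesis
    using assms by (simp add: bij_betw_def card_image card_subset_eq)
qed

lemma submatrix_eq_mat:
  assumes "I \<subseteq> {..<dim_row A}" and "J \<subseteq> {..<dim_col A}"
  shows "submatrix A I J = mat (card I) (card J) (\<lambda>(i, j). A $$ (pick I i, pick J j))"
proof -
  have "{i. i < dim_row A \<and> i \<in> I} = I" "{j. j < dim_col A \<and> j \<in> J} = J"
    using assms by auto
  then show ?thesis
    by (simp add: submatrix_def)
qed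

text \<open>The set \<open>I'\<close> is enumerated by the given enumeration with one value replaced, so that the new
  submatrix can be compared with the old one row by row. If nothing is exchanged, a value is replaced
  by itself, which uses \<open>k \<ge> 1\<close>.\<close>

lemma exchange_enumeration:
  assumes inj: "inj_on \<pi> {..<k}" and k: "1 \<le> k"
    and I': "finite I'" "card I' = k" "card (\<pi> ` {..<k} - I') \<le> 1"
  obtains p x where "p < k" and "bij_betw (\<pi>(p := x)) {..<k} I'"
proof -
  let ?I = "\<pi> ` {..<k}"
  have cardI: "card ?I = k"
    using inj by (simp add: card_image)
  show ?thesis
  proof (cases "?I \<subseteq> I'")
    case True
    then have "?I = I'"
      using I' cardI by (intro card_subset_eq) auto
    then have "bij_betw (\<pi>(0 := \<pi> 0)) {..<k} I'"
      using inj by (simp add: bij_betw_def)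
    then show ?thesis
      using k by (intro that[of 0 "\<pi> 0"]) auto
  next
    case False
    then have "card (?I - I') = 1"
      using I'(3) by (simp add: card_eq_0_iff le_Suc_eq)
    moreover have "card (I' - ?I) = card (?I - I')"
      using I' cardI card_le_sym_Diff[of ?I I'] card_le_sym_Diff[of I' ?I] by simp
    ultimately obtain y x where y: "?I - I' = {y}" and x: "I' - ?I = {x}"
      by (metis card_1_singletonE)
    obtain p where p: "p < k" "y = \<pi> p"
      using y by auto
    have "bij_betw \<pi> ({..<k} - {p}) (?I - {\<pi> p})"
      using inj p by (auto simp: bij_betw_def inj_on_def)
    moreover have "?I - {\<pi> p} = I' - {x}"
      using x y p by blast
    moreover have "bij_betw (\<pi>(p := x)) ({..<k} - {p}) (I' - {x})
        \<longleftrightarrow> bij_betw \<pi> ({..<k} - {p}) (I' - {x})"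
      by (intro bij_betw_cong) auto
    ultimately have "bij_betw (\<pi>(p := x)) ({..<k} - {p}) (I' - {x})"
      by simp
    then have "bij_betw (\<pi>(p := x)) (({..<k} - {p}) \<union> {p}) ((I' - {x}) \<union> {x})"
      by (intro bij_betw_combine) (auto simp: bij_betw_def)
    moreover have "({..<k} - {p}) \<union> {p} = {..<k}" "(I' - {x}) \<union> {x} = I'"
      using p x by auto
    ultimately show ?thesis
      using p that by auto
  qed
qed

section \<open>Permutation matrices and inverses\<close>

lemma permutation_mat_mult_left:
  fixes X :: "real mat"
  assumes \<pi>: "\<pi> permutes {..<m}" and X: "X \<in> carrier_mat m n"
    and ij: "i < m" "j < n"
  shows "(mat m m (\<lambda>(i, j). if j = \<pi> i then 1 else 0) * X) $$ (i, j) = X $$ (\<pi> i, j)"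
proof -
  have "\<pi> i < m"
    using permutes_in_image[OF \<pi>, of i] ij by simp
  then show ?thesis
    using X ij by (simp add: scalar_prod_def if_distrib[of "\<lambda>x. x * _"] cong: if_cong)
qed

lemma permutation_mat_mult_right:
  fixes X :: "real mat"
  assumes \<pi>: "\<pi> permutes {..<n}" and X: "X \<in> carrier_mat m n"
    and ij: "i < m" "j < n"
  shows "(X * mat n n (\<lambda>(i, j). if j = \<pi> i then 1 else 0)) $$ (i, j) = X $$ (i, Hilbert_Choice.inv \<pi> j)"
proof -
  have "Hilbert_Choice.inv \<pi> j < n"
    using permutes_in_image[OF permutes_inv[OF \<pi>], of j] ij by simp
  moreover have "j = \<pi> l \<longleftrightarrow> l = Hilbert_Choice.inv \<pi> j" for l
    using permutes_inverses[OF \<pi>] by metis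
  ultimately show ?thesis
    using X ij by (simp add: scalar_prod_def if_distrib[of "\<lambda>x. _ * x"] cong: if_cong)
qed

lemma mat_inv_inverse:
  fixes M :: "real mat"
  assumes M: "M \<in> carrier_mat k k" and "invertible_mat M"
  shows "mat_inv M \<in> carrier_mat k k" and "M * mat_inv M = 1\<^sub>m k" and "mat_inv M * M = 1\<^sub>m k"
proof -
  obtain B where B: "M * B = 1\<^sub>m k" "B * M = 1\<^sub>m (dim_row B)"
    using assms by (auto simp: invertible_mat_def inverts_mat_def)
  have "dim_col B = k" "dim_row B = k"
    using arg_cong[OF B(1), of dim_col] arg_cong[OF B(2), of dim_col] M by auto
  then have "B \<in> carrier_mat k k" "B * M = 1\<^sub>m k"
    using B by auto
  then have "M \<in> Units (ring_mat TYPE(real) k ())"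
    using M B by (auto simp: Units_def ring_mat_def)
  then obtain N where "mat_inverse M = Some N"
    using mat_inverse(1)[OF M, where b = "()"] by (cases "mat_inverse M") auto
  then show "mat_inv M \<in> carrier_mat k k" "M * mat_inv M = 1\<^sub>m k" "mat_inv M * M = 1\<^sub>m k"
    using mat_inverse(2)[OF M] by (auto simp: mat_inv_def)
qed

section \<open>Near-local maximality of the leading block\<close>

theorem theorem6p1:
  fixes A A11 A12 A21 A22 P1 P2 :: "real mat" and m n k :: nat and \<mu> \<nu> :: real
  assumes A: "A \<in> carrier_mat m n"
    and k: "1 \<le> k" "k \<le> vec_space.rank m A"
    and P1: "permutation_mat m P1"
    and P2: "permutation_mat n P2"
    and A11: "A11 \<in> carrier_mat k k"
    and A12: "A12 \<in> carrier_mat k (n - k)"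
    and A21: "A21 \<in> carrier_mat (m - k) k"
    and A22: "A22 \<in> carrier_mat (m - k) (n - k)"
    and blocks: "P1 * A * P2 = four_block_mat A11 A12 A21 A22"
    and invertible: "invertible_mat A11"
    and partial_LU: "four_block_mat A11 A12 A21 A22 =
        four_block_mat (1\<^sub>m k) (0\<^sub>m k (m - k)) (A21 * mat_inv A11) (1\<^sub>m (m - k)) *
        four_block_mat A11 A12 (0\<^sub>m (m - k) k) (schur_complement A11 A12 A21 A22)"
    and \<mu>: "\<mu> \<ge> 1"
    and \<nu>: "\<nu> \<ge> 1"
    and sigma_k: "sigma k A \<le> \<mu> * sigma k A11"
    and schur: "spectral_norm (schur_complement A11 A12 A21 A22) \<le> \<mu> * sigma (k + 1) A"
    and max_L: "max_norm (A21 * mat_inv A11) \<le> \<nu>"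
    and max_U: "max_norm (mat_inv A11 * A12) \<le> \<nu>"
  shows "\<exists>\<gamma>. \<gamma> \<le> \<nu>\<^sup>2 + \<mu>\<^sup>2 \<and>
           local_max_vol \<gamma> A (leading_rows k P1) (leading_cols k P2) A11"
proof -
  obtain \<pi> where \<pi>: "\<pi> permutes {..<m}" and
    P1_eq: "P1 = mat m m (\<lambda>(i, j). if j = \<pi> i then 1 else 0)"
    using P1 by (auto simp: permutation_mat_def)
  obtain \<tau> where \<tau>: "\<tau> permutes {..<n}" and
    P2_eq: "P2 = mat n n (\<lambda>(i, j). if j = \<tau> i then 1 else 0)"
    using P2 by (auto simp: permutation_mat_def)
  \<comment> \<open>Row \<open>i\<close> of the permuted matrix is row \<open>\<pi> i\<close> of \<open>A\<close>, but column \<open>j\<close> is column \<open>inv \<tau> j\<close>, as a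
    permutation matrix acts from the right by the inverse permutation.\<close>
  define \<rho> where "\<rho> = Hilbert_Choice.inv \<tau>"
  have \<rho>: "\<rho> permutes {..<n}"
    unfolding \<rho>_def by (rule permutes_inv[OF \<tau>])
  have \<tau>_iff: "\<tau> c = j \<longleftrightarrow> c = \<rho> j" for c j
    unfolding \<rho>_def using permutes_inverses[OF \<tau>] by metis
  let ?C = "four_block_mat A11 A12 A21 A22"
  define I J where "I = leading_rows k P1" and "J = leading_cols k P2"
  have P1A: "P1 * A \<in> carrier_mat m n"
    using A by (auto simp: P1_eq)
  \<comment> \<open>As natural subtraction truncates, the dimensions of the blocks force \<open>k \<le> m\<close> and \<open>k \<le> n\<close>.\<close>
  have "dim_row (P1 * A * P2) = m" "dim_col (P1 * A * P2) = n"
    by (simp_all add: P1_eq P2_eq)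
  then have dims: "k + (m - k) = m" "k + (n - k) = n"
    using A11 A22 by (simp_all add: blocks)
  then have kmn: "k \<le> m" "k \<le> n"
    by linarith+
  have C_entry: "?C $$ (i, j) = A $$ (\<pi> i, \<rho> j)" if "i < m" "j < n" for i j
  proof -
    have "\<rho> j < n"
      using permutes_in_image[OF \<rho>, of j] that by simp
    then show ?thesis
      using that permutation_mat_mult_right[OF \<tau> P1A] permutation_mat_mult_left[OF \<pi> A]
      by (simp add: blocks[symmetric] P2_eq[symmetric] P1_eq[symmetric] \<rho>_def)
  qed
  have A11_entry: "A11 $$ (i, j) = A $$ (\<pi> i, \<rho> j)" if "i < k" "j < k" for i j
    using C_entry[of i j] that kmn A11 A22 by simp
  have \<pi>_less: "\<pi> i < m" if "i < m" for i
    using permutes_in_image[OF \<pi>, of i] that by simp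
  have \<rho>_less: "\<rho> j < n" if "j < n" for j
    using permutes_in_image[OF \<rho>, of j] that by simp
  have I: "I = \<pi> ` {..<k}"
    using kmn \<pi>_less by (auto simp: I_def leading_rows_def P1_eq split: if_splits)
  have J: "J = \<rho> ` {..<k}"
  proof -
    have "J = {c. c < n \<and> \<tau> c < k}"
      using kmn by (auto simp: J_def leading_cols_def P2_eq split: if_splits)
    also have "\<dots> = \<rho> ` {..<k}"
    proof (intro Set.set_eqI iffI)
      fix c assume "c \<in> {c. c < n \<and> \<tau> c < k}"
      moreover have "c = \<rho> (\<tau> c)"
        by (simp flip: \<tau>_iff)
      ultimately show "c \<in> \<rho> ` {..<k}"
        by auto
    next
      fix c assume "c \<in> \<rho> ` {..<k}"
      then obtain j where j: "j < k" "c = \<rho> j"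
        by auto
      then have "\<tau> c = j"
        by (simp only: \<tau>_iff)
      then show "c \<in> {c. c < n \<and> \<tau> c < k}"
        using j kmn \<rho>_less by simp
    qed
    finally show ?thesis .
  qed
  have inj: "inj_on \<pi> {..<k}" "inj_on \<rho> {..<k}"
    using permutes_inj[OF \<pi>] permutes_inj[OF \<rho>] by (auto intro: inj_on_subset)
  have card: "card I = k" "card J = k"
    using inj by (simp_all add: I J card_image)
  have range: "I \<subseteq> {..<dim_row A}" "J \<subseteq> {..<dim_col A}"
    using A kmn \<pi>_less \<rho>_less by (auto simp: I J)
  have bij: "bij_betw \<pi> {..<k} I" "bij_betw \<rho> {..<k} J"
    using inj by (simp_all add: bij_betw_def I J)
  have pick: "bij_betw (pick I) {..<k} I" "bij_betw (pick J) {..<k} J"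
    using bij_betw_pick[of I] bij_betw_pick[of J] card by (simp_all add: I J)

  have position: "is_submatrix_at A I J A11"
  proof -
    obtain \<alpha> where \<alpha>: "\<alpha> permutes {..<k}" "\<And>i. i < k \<Longrightarrow> pick I (\<alpha> i) = \<pi> i"
      using bij_betw_differ_by_permutation[OF bij(1) pick(1)] by auto
    obtain \<beta> where \<beta>: "\<beta> permutes {..<k}" "\<And>j. j < k \<Longrightarrow> pick J (\<beta> j) = \<rho> j"
      using bij_betw_differ_by_permutation[OF bij(2) pick(2)] by auto
    let ?\<beta>' = "Hilbert_Choice.inv \<beta>"
    have \<beta>': "?\<beta>' permutes {..<k}"
      by (rule permutes_inv[OF \<beta>(1)])
    let ?P = "mat k k (\<lambda>(i, j). if j = \<alpha> i then 1 else 0) :: real mat"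
    let ?Q = "mat k k (\<lambda>(i, j). if j = ?\<beta>' i then 1 else 0) :: real mat"
    have sub: "submatrix A I J \<in> carrier_mat k k"
      using range by (simp add: submatrix_eq_mat card)
    have PS: "?P * submatrix A I J \<in> carrier_mat k k"
      by (rule mult_carrier_mat[OF _ sub]) simp
    have "A11 = ?P * submatrix A I J * ?Q"
    proof (rule eq_matI)
      fix i j assume "i < dim_row (?P * submatrix A I J * ?Q)" "j < dim_col (?P * submatrix A I J * ?Q)"
      then have ij: "i < k" "j < k"
        by auto
      have \<alpha>\<beta>: "\<alpha> i < k" "\<beta> j < k"
        using permutes_in_image[OF \<alpha>(1), of i] permutes_in_image[OF \<beta>(1), of j] ij by auto
      have "(?P * submatrix A I J * ?Q) $$ (i, j) = (?P * submatrix A I J) $$ (i, \<beta> j)"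
        by (rule permutation_mat_mult_right[OF \<beta>' PS ij, unfolded permutes_inv_inv[OF \<beta>(1)]])
      also have "\<dots> = submatrix A I J $$ (\<alpha> i, \<beta> j)"
        using permutation_mat_mult_left[OF \<alpha>(1) sub] ij \<alpha>\<beta> by simp
      also have "\<dots> = A11 $$ (i, j)"
        using ij \<alpha>\<beta> range by (simp add: submatrix_eq_mat card \<alpha>(2) \<beta>(2) A11_entry)
      finally show "A11 $$ (i, j) = (?P * submatrix A I J * ?Q) $$ (i, j)"
        by simp
    qed (use A11 in auto)
    then show ?thesis
      unfolding is_submatrix_at_def permutation_mat_def card using range \<alpha>(1) \<beta>' by blast
  qed

  define N where "N = mat_inv A11"
  note N = mat_inv_inverse[OF A11 invertible, folded N_def]
  have L_le: "\<bar>(A21 * N) $$ (i, j)\<bar> \<le> \<nu>" if "i < m - k" "j < k" for i j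
    using abs_entry_le_max_norm[of i "A21 * N" j] max_L that A21 N by (simp add: N_def)
  have U_le: "\<bar>(N * A12) $$ (i, j)\<bar> \<le> \<nu>" if "i < k" "j < n - k" for i j
    using abs_entry_le_max_norm[of i "N * A12" j] max_U that A12 N by (simp add: N_def)
  have S_le: "\<bar>(A22 - A21 * N * A12) $$ (i, j)\<bar> * \<bar>N $$ (q, p)\<bar> \<le> \<mu>\<^sup>2"
    if "i < m - k" "j < n - k" "p < k" "q < k" for i j p q
  proof -
    have "\<bar>(A22 - A21 * N * A12) $$ (i, j)\<bar> \<le> spectral_norm (schur_complement A11 A12 A21 A22)"
      unfolding schur_complement_def N_def[symmetric]
      using that A12 A21 A22 by (intro abs_entry_le_spectral_norm) auto
    also have "\<dots> \<le> \<mu> * sigma (k + 1) A"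
      by (rule schur)
    also have "\<dots> \<le> \<mu> * (\<mu> * sigma k A11)"
      using sigma_Suc_le[OF k(1), of A] sigma_k \<mu> by (intro mult_left_mono) auto
    finally have "\<bar>(A22 - A21 * N * A12) $$ (i, j)\<bar> * \<bar>N $$ (q, p)\<bar>
        \<le> \<mu> * (\<mu> * sigma k A11) * \<bar>N $$ (q, p)\<bar>"
      by (rule mult_right_mono) simp
    also have "\<dots> = \<mu>\<^sup>2 * (sigma k A11 * \<bar>N $$ (q, p)\<bar>)"
      by (simp add: power2_eq_square)
    also have "\<dots> \<le> \<mu>\<^sup>2 * 1"
      using abs_entry_inverse_le[OF A11 N(1,2)] that by (intro mult_left_mono) auto
    finally show ?thesis
      by simp
  qed

  have exchange: "vol (submatrix A I' J') \<le> (\<nu>\<^sup>2 + \<mu>\<^sup>2) * vol A11"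
    if I': "I' \<subseteq> {..<dim_row A}" "card I' = card I" "card (I - I') \<le> 1"
      and J': "J' \<subseteq> {..<dim_col A}" "card J' = card J" "card (J - J') \<le> 1" for I' J'
  proof -
    have fin: "finite I'" "finite J'"
      using I' J' by (auto intro: finite_subset)
    obtain p x where p: "p < k" and f: "bij_betw (\<pi>(p := x)) {..<k} I'"
      using exchange_enumeration[OF inj(1) k(1) fin(1)] I' card by (auto simp: I)
    obtain q y where q: "q < k" and g: "bij_betw (\<rho>(q := y)) {..<k} J'"
      using exchange_enumeration[OF inj(2) k(1) fin(2)] J' card by (auto simp: J)
    have "x < m" "y < n"
      using bij_betw_apply[OF f, of p] bij_betw_apply[OF g, of q] p q I'(1) J'(1) A by auto
    then obtain p' q' where p': "p' < m" "x = \<pi> p'" and q': "q' < n" "y = \<rho> q'"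
      using permutes_image[OF \<pi>] permutes_image[OF \<rho>] by (metis imageE lessThan_iff)
    have sub: "submatrix A I' J' = mat k k (\<lambda>(i, j). A $$ (pick I' i, pick J' j))"
      using I' J' card by (simp add: submatrix_eq_mat)
    have "vol (submatrix A I' J') = \<bar>det (submatrix A I' J')\<bar>"
      by (rule vol_square_matrix[of _ k]) (simp add: sub)
    also have "\<dots> = \<bar>det (mat k k (\<lambda>(i, j). A $$ ((\<pi>(p := x)) i, (\<rho>(q := y)) j)))\<bar>"
      unfolding sub using bij_betw_pick[OF fin(1)] bij_betw_pick[OF fin(2)] I' J' card
      by (intro abs_det_reorder[OF _ f _ g, of _ _ "\<lambda>a b. A $$ (a, b)"]) simp_all
    also have "mat k k (\<lambda>(i, j). A $$ ((\<pi>(p := x)) i, (\<rho>(q := y)) j))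
        = mat k k (\<lambda>(i, j). ?C $$ (if i = p then p' else i, if j = q then q' else j))"
      using kmn p' q' by (intro cong_mat) (auto simp: C_entry)
    also have "\<bar>det \<dots>\<bar> \<le> (\<nu>\<^sup>2 + \<mu>\<^sup>2) * \<bar>det A11\<bar>"
      using L_le U_le S_le p q p' q' dims \<nu>
      by (intro abs_det_exchange_le[OF A11 A12 A21 A22 N]) auto
    finally show ?thesis
      by (simp add: vol_square_matrix[OF A11])
  qed

  have "1 \<le> \<nu>\<^sup>2" "1 \<le> \<mu>\<^sup>2"
    using \<nu> \<mu> by (simp_all add: one_le_power)
  then have "1 < \<nu>\<^sup>2 + \<mu>\<^sup>2"
    by linarith
  then have "local_max_vol (\<nu>\<^sup>2 + \<mu>\<^sup>2) A I J A11"
    unfolding local_max_vol_def using position exchange by (auto simp: pos_divide_le_eq mult.commute)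
  then show ?thesis
    unfolding I_def J_def by blast
qed

end
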